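(* Let $S$ be a nondegenerate $n$-dimensional simplex with $S\subset Q_n\subset nS$. Then replacing any vertex of $S$ by an arbitrary point of $Q_n$ yields a simplex whose volume does not exceed $\mathrm{vol}(S)$.
   Context: $Q_n=[0,1]^n$. $nS$ denotes the image of $S$ under the homothety with center at the center of gravity of $S$ and ratio $n$. *)

theory Defs
  imports "HOL-Analysis.Analysis"
begin

text \<open>The unit cube Q_n = [0,1]^n, with n = CARD('n).\<close>
definition unit_cube :: "(real^'n) set" where
  "unit_cube = {x. \<forall>i. 0 \<le> x $ i \<and> x $ i \<le> 1}"

text \<open>Simplex with vertices v 0, ..., v n, where n = CARD('n).\<close>
definition simplex_of :: "(nat \<Rightarrow> real^'n) \<Rightarrow> (real^'n) set" where
  "simplex_of v = convex hull (v ` {..CARD('n)})"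

text \<open>Nondegenerate n-simplex: n+1 distinct affinely independent vertices.\<close>
definition nondegenerate_simplex :: "(nat \<Rightarrow> real^'n) \<Rightarrow> bool" where
  "nondegenerate_simplex v \<longleftrightarrow>
     inj_on v {..CARD('n)} \<and> \<not> affine_dependent (v ` {..CARD('n)})"

text \<open>Center of gravity of the simplex (= average of its vertices).\<close>
definition simplex_centroid :: "(nat \<Rightarrow> real^'n) \<Rightarrow> real^'n" where
  "simplex_centroid v = (1 / real (CARD('n) + 1)) *\<^sub>R (\<Sum>i\<le>CARD('n). v i)"

text \<open>Image of the simplex under the homothety with center the centroid and ratio r.\<close>
definition scaled_simplex :: "real \<Rightarrow> (nat \<Rightarrow> real^'n) \<Rightarrow> (real^'n) set" where
  "scaled_simplex r v =
     (\<lambda>x. simplex_centroid v + r *\<^sub>R (x - simplex_centroid v)) ` simplex_of v"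

end

theory Submission
  imports Defs
begin

(* Let \<lambda> be the barycentric coordinates with respect to the vertices of S. Replacing vertex j by x
   multiplies the volume by |\<lambda>_j(x)|, so it suffices to show |\<lambda>_j| \<le> 1 on Q_n.
   From Q_n \<subseteq> nS every \<lambda>_k is at least (1 - n)/(n + 1) > -1 on Q_n. For the upper bound write
   \<lambda>_k(y) = \<lambda>_k(0) + \<Sum>_i y_i d_ik; the minimum of \<lambda>_k over the cube is attained at a corner,
   and summing the lower bounds at these corners over k gives \<Sum>_i \<Sum>_k max(-d_ik, 0) \<le> n.
   On the other hand S \<subseteq> Q_n forces \<Sum>_k max(-d_ik, 0) \<ge> 1 for every i. So equality holds, which
   fixes the coordinates of the vertex v_j: v_ji = 1 where d_ij > 0 and v_ji = 0 where d_ij < 0.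
   Hence \<lambda>_j is maximal on Q_n at v_j, where it equals 1. *)

lemma affine_hull_nondegenerate_simplex:
  fixes v :: "nat \<Rightarrow> real^'n"
  assumes "nondegenerate_simplex v"
  shows "affine hull (v ` {..CARD('n)}) = UNIV"
proof -
  have inj: "inj_on v {..CARD('n)}" and ind: "\<not> affine_dependent (v ` {..CARD('n)})"
    using assms by (auto simp: nondegenerate_simplex_def)
  have "int (card (v ` {..CARD('n)})) = aff_dim (v ` {..CARD('n)}) + 1"
    by (rule aff_dim_affine_independent[OF ind])
  moreover have "card (v ` {..CARD('n)}) = CARD('n) + 1"
    using inj by (simp add: card_image)
  ultimately show ?thesis
    using aff_dim_eq_full[of "v ` {..CARD('n)}"] by simp
qed

(* Meaningful only for nondegenerate v and k \<le> CARD('n). *)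
definition barycentric :: "(nat \<Rightarrow> real^'n) \<Rightarrow> real^'n \<Rightarrow> nat \<Rightarrow> real" where
  "barycentric v y = (SOME \<mu>. sum \<mu> {..CARD('n)} = 1 \<and> (\<Sum>k\<le>CARD('n). \<mu> k *\<^sub>R v k) = y)"

lemma barycentric_exists:
  fixes v :: "nat \<Rightarrow> real^'n"
  assumes "nondegenerate_simplex v"
  shows "\<exists>\<mu>. sum \<mu> {..CARD('n)} = 1 \<and> (\<Sum>k\<le>CARD('n). \<mu> k *\<^sub>R v k) = y"
proof -
  have inj: "inj_on v {..CARD('n)}"
    using assms by (simp add: nondegenerate_simplex_def)
  obtain u where "sum u (v ` {..CARD('n)}) = 1" "(\<Sum>w\<in>v ` {..CARD('n)}. u w *\<^sub>R w) = y"
    using affine_hull_nondegenerate_simplex[OF assms] by (force simp: affine_hull_finite)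
  with inj show ?thesis
    by (intro exI[of _ "u \<circ> v"]) (simp add: sum.reindex)
qed

lemma
  fixes v :: "nat \<Rightarrow> real^'n"
  assumes "nondegenerate_simplex v"
  shows sum_barycentric: "sum (barycentric v y) {..CARD('n)} = 1"
    and barycentric_combination: "(\<Sum>k\<le>CARD('n). barycentric v y k *\<^sub>R v k) = y"
  using someI_ex[OF barycentric_exists[OF assms, of y]] by (simp_all add: barycentric_def)

lemma affine_independent_coeff_eq_0:
  fixes v :: "nat \<Rightarrow> real^'n"
  assumes "nondegenerate_simplex v" "sum d {..CARD('n)} = 0"
    and "(\<Sum>k\<le>CARD('n). d k *\<^sub>R v k) = 0" "k \<le> CARD('n)"
  shows "d k = 0"
proof (rule ccontr)
  assume "d k \<noteq> 0"
  have inj: "inj_on v {..CARD('n)}" and ind: "\<not> affine_dependent (v ` {..CARD('n)})"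
    using assms(1) by (auto simp: nondegenerate_simplex_def)
  define u where "u = d \<circ> the_inv_into {..CARD('n)} v"
  have uv: "u (v i) = d i" if "i \<le> CARD('n)" for i
    using inj that by (simp add: u_def the_inv_into_f_f)
  have "sum u (v ` {..CARD('n)}) = 0" "(\<Sum>w\<in>v ` {..CARD('n)}. u w *\<^sub>R w) = 0"
    using assms(2,3) inj uv by (simp_all add: sum.reindex)
  moreover have "u (v k) \<noteq> 0"
    using \<open>d k \<noteq> 0\<close> assms(4) uv by simp
  ultimately have "affine_dependent (v ` {..CARD('n)})"
    using assms(4) unfolding affine_dependent_explicit_finite[OF finite_imageI[OF finite_atMost]]
    by blast
  with ind show False by simp
qed

lemma barycentric_eqI:
  fixes v :: "nat \<Rightarrow> real^'n"
  assumes "nondegenerate_simplex v" "sum \<mu> {..CARD('n)} = 1"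
    and "(\<Sum>k\<le>CARD('n). \<mu> k *\<^sub>R v k) = y" "k \<le> CARD('n)"
  shows "barycentric v y k = \<mu> k"
proof -
  have "barycentric v y k - \<mu> k = 0"
    using assms
    by (intro affine_independent_coeff_eq_0[OF assms(1), where d = "\<lambda>k. barycentric v y k - \<mu> k"])
       (simp_all add: sum_subtractf scaleR_diff_left sum_barycentric barycentric_combination)
  then show ?thesis by simp
qed

lemma barycentric_vertex:
  fixes v :: "nat \<Rightarrow> real^'n"
  assumes "nondegenerate_simplex v" "j \<le> CARD('n)" "k \<le> CARD('n)"
  shows "barycentric v (v j) k = (if k = j then 1 else 0)"
  using assms by (intro barycentric_eqI) (simp_all add: if_distrib[of "\<lambda>t. t *\<^sub>R _"] cong: if_cong)

definition barycentric_direction :: "(nat \<Rightarrow> real^'n) \<Rightarrow> 'n \<Rightarrow> nat \<Rightarrow> real" where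
  "barycentric_direction v i k = barycentric v (axis i 1) k - barycentric v 0 k"

lemma sum_barycentric_direction:
  fixes v :: "nat \<Rightarrow> real^'n"
  assumes "nondegenerate_simplex v"
  shows "sum (barycentric_direction v i) {..CARD('n)} = 0"
  using assms by (simp add: barycentric_direction_def sum_subtractf sum_barycentric)

lemma barycentric_direction_combination:
  fixes v :: "nat \<Rightarrow> real^'n"
  assumes "nondegenerate_simplex v"
  shows "(\<Sum>k\<le>CARD('n). barycentric_direction v i k *\<^sub>R v k) = axis i 1"
  using assms
  by (simp add: barycentric_direction_def scaleR_diff_left sum_subtractf barycentric_combination)

lemma barycentric_affine:
  fixes v :: "nat \<Rightarrow> real^'n"
  assumes "nondegenerate_simplex v" "k \<le> CARD('n)"
  shows "barycentric v y k = barycentric v 0 k + (\<Sum>i\<in>UNIV. y $ i * barycentric_direction v i k)"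
proof (rule barycentric_eqI[OF assms(1) _ _ assms(2)])
  let ?d = "barycentric_direction v"
  have "(\<Sum>k\<le>CARD('n). \<Sum>i\<in>UNIV. y $ i * ?d i k) = 0"
    using sum_barycentric_direction[OF assms(1)]
    by (subst sum.swap) (simp add: sum_distrib_left[symmetric])
  then show "(\<Sum>k\<le>CARD('n). barycentric v 0 k + (\<Sum>i\<in>UNIV. y $ i * ?d i k)) = 1"
    using assms(1) by (simp add: sum.distrib sum_barycentric)
  have "(\<Sum>k\<le>CARD('n). (\<Sum>i\<in>UNIV. y $ i * ?d i k) *\<^sub>R v k)
      = (\<Sum>i\<in>UNIV. y $ i *\<^sub>R (\<Sum>k\<le>CARD('n). ?d i k *\<^sub>R v k))"
    by (simp add: scaleR_sum_left scaleR_sum_right sum.swap[of _ "{..CARD('n)}"])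
  also have "\<dots> = y"
    by (simp add: barycentric_direction_combination[OF assms(1)])
       (simp add: vec_eq_iff sum_component axis_def if_distrib cong: if_cong)
  finally show
    "(\<Sum>k\<le>CARD('n). (barycentric v 0 k + (\<Sum>i\<in>UNIV. y $ i * ?d i k)) *\<^sub>R v k) = y"
    using assms(1) by (simp add: scaleR_add_left sum.distrib barycentric_combination)
qed

lemma barycentric_nonneg:
  fixes v :: "nat \<Rightarrow> real^'n"
  assumes "nondegenerate_simplex v" "z \<in> simplex_of v" "k \<le> CARD('n)"
  shows "0 \<le> barycentric v z k"
proof -
  have inj: "inj_on v {..CARD('n)}"
    using assms(1) by (simp add: nondegenerate_simplex_def)
  obtain u where "\<forall>w\<in>v ` {..CARD('n)}. 0 \<le> u w" "sum u (v ` {..CARD('n)}) = 1"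
      "(\<Sum>w\<in>v ` {..CARD('n)}. u w *\<^sub>R w) = z"
    using assms(2) by (auto simp: simplex_of_def convex_hull_finite)
  with inj assms have "barycentric v z k = u (v k)"
    by (intro barycentric_eqI) (simp_all add: sum.reindex)
  with \<open>\<forall>w\<in>v ` {..CARD('n)}. 0 \<le> u w\<close> assms(3) show ?thesis by simp
qed

lemma barycentric_scaled_simplex_ge:
  fixes v :: "nat \<Rightarrow> real^'n"
  assumes "nondegenerate_simplex v" "0 \<le> r" "y \<in> scaled_simplex r v" "k \<le> CARD('n)"
  shows "(1 - r) / (CARD('n) + 1) \<le> barycentric v y k"
proof -
  define c where "c = simplex_centroid v"
  obtain z where z: "z \<in> simplex_of v" and y: "y = c + r *\<^sub>R (z - c)"
    using assms(3) by (auto simp: scaled_simplex_def c_def)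
  define \<mu> where "\<mu> k = r * barycentric v z k + (1 - r) / (CARD('n) + 1)" for k
  have sum_\<mu>: "sum \<mu> {..CARD('n)} = 1"
    using assms(1) by (simp add: \<mu>_def sum.distrib sum_barycentric flip: sum_distrib_left)
  have "(\<Sum>k\<le>CARD('n). (r * barycentric v z k) *\<^sub>R v k) = r *\<^sub>R z"
    using assms(1) by (simp add: barycentric_combination flip: scaleR_scaleR scaleR_sum_right)
  then have "(\<Sum>k\<le>CARD('n). \<mu> k *\<^sub>R v k) = r *\<^sub>R z + (1 - r) *\<^sub>R c"
    by (simp add: \<mu>_def c_def simplex_centroid_def scaleR_add_left sum.distrib scaleR_sum_right)
  moreover have "\<dots> = y"
    by (simp add: y algebra_simps)
  ultimately have "barycentric v y k = \<mu> k"
    using assms(1,4) sum_\<mu> by (intro barycentric_eqI) simp_all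
  then show ?thesis
    using assms barycentric_nonneg[OF assms(1) z assms(4)] by (simp add: \<mu>_def)
qed

lemma sum_neg_part_ge_one:
  fixes a p :: "'k \<Rightarrow> real"
  assumes "finite K" "sum a K = 0" "(\<Sum>k\<in>K. a k * p k) = 1"
    and "\<And>k. k \<in> K \<Longrightarrow> 0 \<le> p k \<and> p k \<le> 1"
  shows "1 \<le> (\<Sum>k\<in>K. max (- a k) 0)"
proof -
  have "(\<Sum>k\<in>K. a k * p k) \<le> (\<Sum>k\<in>K. max (a k) 0)"
    using assms(4) by (intro sum_mono) (auto simp: max_def mult_left_le mult_nonpos_nonneg)
  also have "\<dots> = (\<Sum>k\<in>K. max (- a k) 0) + sum a K"
    by (auto simp: sum.distrib[symmetric] max_def intro!: sum.cong)
  finally show ?thesis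
    using assms(2,3) by simp
qed

lemma sum_neg_part_eq_one_sign:
  fixes a p :: "'k \<Rightarrow> real"
  assumes "finite K" "sum a K = 0" "(\<Sum>k\<in>K. a k * p k) = 1"
    and "\<And>k. k \<in> K \<Longrightarrow> 0 \<le> p k \<and> p k \<le> 1"
    and "(\<Sum>k\<in>K. max (- a k) 0) = 1" "k \<in> K" "0 \<le> t" "t \<le> 1"
  shows "a k * (t - p k) \<le> 0"
proof -
  define slack where "slack k = max (a k) 0 * (1 - p k) + max (- a k) 0 * p k" for k
  have slack_nonneg: "0 \<le> slack k" if "k \<in> K" for k
    using assms(4)[OF that] by (simp add: slack_def)
  have "sum slack K = (\<Sum>k\<in>K. max (- a k) 0) + sum a K - (\<Sum>k\<in>K. a k * p k)"
    by (auto simp: slack_def sum.distrib[symmetric] sum_subtractf[symmetric] max_def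
        algebra_simps intro!: sum.cong)
  then have "sum slack K = 0"
    using assms(2,3,5) by simp
  then have "slack k = 0"
    using sum_nonneg_eq_0_iff[OF assms(1)] slack_nonneg assms(6) by blast
  then show ?thesis
    using assms(4)[OF assms(6)] assms(7,8)
    by (cases "a k" "0::real" rule: linorder_cases)
       (auto simp: slack_def max_def mult_nonpos_nonneg mult_nonneg_nonpos)
qed

lemma unit_cube_vertex:
  fixes v :: "nat \<Rightarrow> real^'n"
  assumes "simplex_of v \<subseteq> unit_cube" "k \<le> CARD('n)"
  shows "0 \<le> v k $ i \<and> v k $ i \<le> 1"
  using assms by (auto simp: simplex_of_def unit_cube_def intro!: hull_inc)

lemma barycentric_direction_vertex_component:
  fixes v :: "nat \<Rightarrow> real^'n"
  assumes "nondegenerate_simplex v"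
  shows "(\<Sum>k\<le>CARD('n). barycentric_direction v i k * v k $ i) = 1"
  using arg_cong[OF barycentric_direction_combination[OF assms], of "\<lambda>y. y $ i"]
  by (simp add: sum_component)

(* The k-th coordinate is smallest on the cube at corner k; apply the lower bound from
   Q_n \<subseteq> nS there and sum over k. *)
lemma sum_neg_barycentric_direction_le:
  fixes v :: "nat \<Rightarrow> real^'n"
  assumes nd: "nondegenerate_simplex v"
    and sup: "unit_cube \<subseteq> scaled_simplex (real CARD('n)) v"
  shows "(\<Sum>i\<in>UNIV. \<Sum>k\<le>CARD('n). max (- barycentric_direction v i k) 0) \<le> CARD('n)"
proof -
  let ?K = "{..CARD('n)}"
  let ?neg = "\<lambda>i k. max (- barycentric_direction v i k) 0"
  define corner where "corner k = (\<chi> i. if barycentric_direction v i k < 0 then 1 else (0::real))"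
    for k
  have corner_value: "barycentric v (corner k) k = barycentric v 0 k - (\<Sum>i\<in>UNIV. ?neg i k)"
    if "k \<in> ?K" for k
  proof -
    have "(\<Sum>i\<in>UNIV. corner k $ i * barycentric_direction v i k) = - (\<Sum>i\<in>UNIV. ?neg i k)"
      by (auto simp: corner_def max_def sum_negf[symmetric] intro!: sum.cong)
    then show ?thesis
      using barycentric_affine[OF nd, of k "corner k"] that by simp
  qed
  have "(1 - real CARD('n)) / (CARD('n) + 1) \<le> barycentric v (corner k) k" if "k \<in> ?K" for k
    using that sup
    by (intro barycentric_scaled_simplex_ge[OF nd]) (auto simp: corner_def unit_cube_def)
  then have "(\<Sum>k\<in>?K. (1 - real CARD('n)) / (CARD('n) + 1))
               \<le> (\<Sum>k\<in>?K. barycentric v 0 k - (\<Sum>i\<in>UNIV. ?neg i k))"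
    by (intro sum_mono) (simp add: corner_value)
  also have "\<dots> = 1 - (\<Sum>i\<in>UNIV. \<Sum>k\<in>?K. ?neg i k)"
    using nd by (simp add: sum_subtractf sum_barycentric sum.swap[of "\<lambda>i k. ?neg k i" UNIV ?K])
  finally show ?thesis
    by simp
qed

lemma barycentric_le_one_on_unit_cube:
  fixes v :: "nat \<Rightarrow> real^'n"
  assumes nd: "nondegenerate_simplex v"
    and sub: "simplex_of v \<subseteq> unit_cube"
    and sup: "unit_cube \<subseteq> scaled_simplex (real CARD('n)) v"
    and j: "j \<le> CARD('n)" and x: "x \<in> unit_cube"
  shows "barycentric v x j \<le> 1"
proof -
  let ?K = "{..CARD('n)}"
  let ?d = "barycentric_direction v"
  let ?neg = "\<lambda>i. \<Sum>k\<in>?K. max (- ?d i k) 0"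
  have row_ge: "1 \<le> ?neg i" for i
    using sum_barycentric_direction[OF nd] barycentric_direction_vertex_component[OF nd]
      unit_cube_vertex[OF sub]
    by (intro sum_neg_part_ge_one[where p = "\<lambda>k. v k $ i"]) auto
  then have "(\<Sum>i\<in>UNIV. ?neg i - 1) = 0"
    using sum_neg_barycentric_direction_le[OF nd sup] sum_mono[of UNIV "\<lambda>_. 1" ?neg]
    by (simp add: sum_subtractf)
  then have row_eq: "?neg i = 1" for i
    using row_ge sum_nonneg_eq_0_iff[of UNIV "\<lambda>i. ?neg i - 1"] by simp
  have "?d i j * (x $ i - v j $ i) \<le> 0" for i
    using sum_barycentric_direction[OF nd] barycentric_direction_vertex_component[OF nd]
      unit_cube_vertex[OF sub] row_eq[of i] j x
    by (intro sum_neg_part_eq_one_sign[where K = ?K and p = "\<lambda>k. v k $ i"])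
       (auto simp: unit_cube_def)
  then have "(\<Sum>i\<in>UNIV. x $ i * ?d i j) \<le> (\<Sum>i\<in>UNIV. v j $ i * ?d i j)"
    by (intro sum_mono) (simp add: algebra_simps)
  then have "barycentric v x j \<le> barycentric v (v j) j"
    using barycentric_affine[OF nd j, of x] barycentric_affine[OF nd j, of "v j"] by linarith
  then show ?thesis
    using barycentric_vertex[OF nd j j] by simp
qed

lemma measure_convex_hull_edge_matrix:
  fixes w :: "nat \<Rightarrow> real^'m::{finite,wellorder}" and g :: "'m::{finite,wellorder} \<Rightarrow> nat"
  assumes g: "bij_betw g UNIV ({..N} - {b})" and "b \<le> N"
  shows "measure lebesgue (convex hull (w ` {..N}))
           = \<bar>det (\<chi> r s. (w (g s) - w b) $ r)\<bar>
             * measure lebesgue (convex hull (insert 0 Basis :: (real^'m::{finite,wellorder}) set))"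
proof -
  define E where "E = (\<chi> r s. (w (g s) - w b) $ r)"
  have E_axis: "E *v axis s 1 = w (g s) - w b" for s
    by (simp add: E_def matrix_vector_mult_basis column_def vec_eq_iff)
  have "(+) (w b) ` ((*v) E ` insert 0 Basis) = insert (w b) ((w \<circ> g) ` UNIV)"
    by (auto simp: Basis_vec_def E_axis image_iff)
  also have "\<dots> = w ` insert b (range g)"
    by (simp add: image_comp)
  also have "insert b (range g) = {..N}"
    using g \<open>b \<le> N\<close> by (auto simp: bij_betw_def)
  finally have vertices: "(+) (w b) ` ((*v) E ` insert 0 Basis) = w ` {..N}" .
  have "convex hull (w ` {..N}) = (+) (w b) ` ((*v) E ` (convex hull (insert 0 Basis)))"
    unfolding vertices[symmetric] convex_hull_translation
      convex_hull_linear_image[OF matrix_vector_mul_linear] ..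
  then have "measure lebesgue (convex hull (w ` {..N}))
               = measure lebesgue ((*v) E ` (convex hull (insert 0 Basis)))"
    by (simp add: measure_translation)
  also have "\<dots> = \<bar>det (matrix ((*v) E))\<bar>
                   * measure lebesgue (convex hull (insert 0 Basis :: (real^'m::{finite,wellorder}) set))"
    by (intro measure_linear_image lmeasurable_compact finite_imp_compact_convex_hull) simp_all
  finally show ?thesis
    by (simp add: E_def)
qed

lemma measure_simplex_replace_vertex_wellorder:
  fixes w :: "nat \<Rightarrow> real^'m::{finite,wellorder}"
  assumes "j \<le> CARD('m)" "sum c {..CARD('m)} = 1" "x = (\<Sum>k\<le>CARD('m). c k *\<^sub>R w k)"
  shows "measure lebesgue (simplex_of (w(j := x))) = \<bar>c j\<bar> * measure lebesgue (simplex_of w)"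
proof -
  define N where "N = CARD('m)"
  define b where "b = (if j = 0 then 1 else 0 :: nat)"
  have "b \<le> N" "b \<noteq> j"
    by (auto simp: b_def N_def Suc_le_eq)
  then have "card ({..N} - {b}) = CARD('m)"
    by (simp add: N_def)
  then obtain g :: "'m \<Rightarrow> nat" where g: "bij_betw g UNIV ({..N} - {b})"
    by (metis bij_betw_iff_card finite_Diff finite_atMost finite_class.finite_UNIV)
  then obtain s0 where s0: "g s0 = j"
    using \<open>b \<le> N\<close> \<open>b \<noteq> j\<close> assms(1)
    by (metis DiffI N_def atMost_iff bij_betw_iff_bijections singletonD)
  define E where "E = (\<chi> r s. (w (g s) - w b) $ r)"
  define c' where "c' = (\<chi> s. c (g s))"
  have "E *v c' = (\<Sum>s\<in>UNIV. c (g s) *\<^sub>R (w (g s) - w b))"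
    by (simp add: vec_eq_iff matrix_vector_mult_def E_def c'_def sum_component mult.commute)
  also have "\<dots> = (\<Sum>k\<in>{..N} - {b}. c k *\<^sub>R (w k - w b))"
    using sum.reindex_bij_betw[OF g] by simp
  also have "\<dots> = (\<Sum>k\<le>N. c k *\<^sub>R (w k - w b))"
    using \<open>b \<le> N\<close> by (subst sum.remove[of "{..N}" b]) auto
  also have "\<dots> = x - w b"
    using assms(2,3) by (simp add: N_def scaleR_diff_right sum_subtractf flip: scaleR_sum_left)
  finally have Ec': "E *v c' = x - w b" .
  have "(w(j := x)) (g s) - (w(j := x)) b = (if s = s0 then E *v c' else w (g s) - w b)" for s
    using \<open>b \<noteq> j\<close> s0 g by (auto simp: Ec' bij_betw_def inj_eq)
  moreover have "E $ r $ s = (w (g s) - w b) $ r" for r s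
    by (simp add: E_def)
  ultimately have "(\<chi> r s. ((w(j := x)) (g s) - (w(j := x)) b) $ r)
                     = (\<chi> r s. if s = s0 then (E *v c') $ r else E $ r $ s)"
    by (simp add: vec_eq_iff)
  \<comment> \<open>moving vertex j replaces column s0 of the edge matrix E by E *v c' (Cramer)\<close>
  then have det_replaced: "det (\<chi> r s. ((w(j := x)) (g s) - (w(j := x)) b) $ r) = c j * det E"
    by (simp add: cramer_lemma c'_def s0)
  let ?std = "measure lebesgue (convex hull (insert 0 Basis :: (real^'m::{finite,wellorder}) set))"
  have "measure lebesgue (simplex_of (w(j := x))) = \<bar>c j * det E\<bar> * ?std"
    unfolding simplex_of_def N_def[symmetric] det_replaced[symmetric]
    by (rule measure_convex_hull_edge_matrix[OF g \<open>b \<le> N\<close>])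
  moreover have "measure lebesgue (simplex_of w) = \<bar>det E\<bar> * ?std"
    unfolding simplex_of_def N_def[symmetric] E_def
    by (rule measure_convex_hull_edge_matrix[OF g \<open>b \<le> N\<close>])
  ultimately show ?thesis
    by (simp add: abs_mult)
qed

(* measure_linear_image needs an index type of class wellorder. A copy of an arbitrary finite
   index type, ordered via to_nat, and the measure preserving relabelling copy_vec remove
   that restriction. *)
typedef 'a ordered_copy = "UNIV :: 'a::finite set" ..

instance ordered_copy :: (finite) finite
  by standard (metis finite_imageI finite_class.finite_UNIV type_definition.Abs_image type_definition_ordered_copy)

instantiation ordered_copy :: (finite) wellorder
begin

definition less_eq_ordered_copy :: "'a ordered_copy \<Rightarrow> 'a ordered_copy \<Rightarrow> bool" where
  "x \<le> y \<longleftrightarrow> to_nat (Rep_ordered_copy x) \<le> to_nat (Rep_ordered_copy y)"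

definition less_ordered_copy :: "'a ordered_copy \<Rightarrow> 'a ordered_copy \<Rightarrow> bool" where
  "x < y \<longleftrightarrow> to_nat (Rep_ordered_copy x) < to_nat (Rep_ordered_copy y)"

instance
proof
  fix x y z :: "'a ordered_copy"
  show "x < y \<longleftrightarrow> x \<le> y \<and> \<not> y \<le> x" "x \<le> x" "x \<le> y \<or> y \<le> x"
    by (auto simp: less_eq_ordered_copy_def less_ordered_copy_def)
  show "x \<le> y \<Longrightarrow> y \<le> z \<Longrightarrow> x \<le> z"
    by (simp add: less_eq_ordered_copy_def)
  show "x \<le> y \<Longrightarrow> y \<le> x \<Longrightarrow> x = y"
    by (metis Rep_ordered_copy_inject antisym less_eq_ordered_copy_def to_nat_split)
next
  fix P :: "'a ordered_copy \<Rightarrow> bool" and a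
  assume step: "\<And>x. (\<And>y. y < x \<Longrightarrow> P y) \<Longrightarrow> P x"
  show "P a"
    by (induction a rule: measure_induct_rule[of "\<lambda>x. to_nat (Rep_ordered_copy x)"])
       (rule step, simp add: less_ordered_copy_def)
qed

end

lemma bij_Abs_ordered_copy: "bij Abs_ordered_copy"
  by (rule bij_betwI[where g = Rep_ordered_copy]) (auto simp: Abs_ordered_copy_inverse Rep_ordered_copy_inverse)

lemma card_ordered_copy: "CARD('a::finite ordered_copy) = CARD('a)"
  by (rule type_definition.card[OF type_definition_ordered_copy])

definition copy_vec :: "real^'a::finite \<Rightarrow> real^'a ordered_copy" where
  "copy_vec x = (\<chi> i. x $ Rep_ordered_copy i)"

definition uncopy_vec :: "real^'a::finite ordered_copy \<Rightarrow> real^'a" where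
  "uncopy_vec y = (\<chi> i. y $ Abs_ordered_copy i)"

lemma uncopy_copy_vec [simp]: "uncopy_vec (copy_vec x) = x"
  by (simp add: uncopy_vec_def copy_vec_def Abs_ordered_copy_inverse vec_eq_iff)

lemma copy_uncopy_vec [simp]: "copy_vec (uncopy_vec y) = y"
  by (simp add: uncopy_vec_def copy_vec_def Rep_ordered_copy_inverse vec_eq_iff)

lemma linear_copy_vec: "linear copy_vec"
  by (auto simp: linear_iff copy_vec_def vec_eq_iff)

lemma linear_uncopy_vec: "linear uncopy_vec"
  by (auto simp: linear_iff uncopy_vec_def vec_eq_iff)

lemma prod_Basis_vec: "(\<Prod>b\<in>(Basis :: (real^'n) set). f b) = (\<Prod>i\<in>UNIV. f (axis i 1))"
proof -
  have basis: "(Basis :: (real^'n) set) = range (\<lambda>i. axis i 1)"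
    by (auto simp: Basis_vec_def)
  have "inj (\<lambda>i::'n. axis i (1::real))"
    by (auto simp: inj_def axis_eq_axis)
  then show ?thesis
    unfolding basis by (subst prod.reindex) (simp_all add: o_def)
qed

lemma borel_measurable_linear:
  fixes f :: "'a::euclidean_space \<Rightarrow> 'b::euclidean_space"
  shows "linear f \<Longrightarrow> f \<in> borel_measurable borel"
  by (intro borel_measurable_continuous_onI linear_continuous_on) (simp add: linear_conv_bounded_linear)

lemma distr_lborel_copy_vec: "distr lborel borel (copy_vec :: real^'a::finite \<Rightarrow> _) = lborel"
proof (rule lborel_eqI[symmetric])
  fix l u :: "real^'a ordered_copy"
  assume le_Basis: "\<And>b. b \<in> Basis \<Longrightarrow> l \<bullet> b \<le> u \<bullet> b"
  have "l $ i \<le> u $ i" for i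
    using le_Basis[of "axis i 1"] by (simp add: inner_axis)
  then have le: "uncopy_vec l \<bullet> b \<le> uncopy_vec u \<bullet> b" if "b \<in> Basis" for b
    using that by (auto simp: Basis_vec_def uncopy_vec_def inner_axis)
  have reindex: "(\<forall>i. P i (Rep_ordered_copy i)) \<longleftrightarrow> (\<forall>k. P (Abs_ordered_copy k) k)" for P
    by (metis Abs_ordered_copy_inverse Rep_ordered_copy_inverse UNIV_I)
  have "x \<in> copy_vec -` box l u \<longleftrightarrow> x \<in> box (uncopy_vec l) (uncopy_vec u)" for x
    using reindex[of "\<lambda>i k. l $ i < x $ k \<and> x $ k < u $ i"]
    by (simp add: mem_box_cart copy_vec_def uncopy_vec_def)
  then have "copy_vec -` box l u = box (uncopy_vec l) (uncopy_vec u)"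
    by blast
  then have "emeasure (distr lborel borel copy_vec) (box l u)
               = emeasure lborel (box (uncopy_vec l) (uncopy_vec u))"
    by (simp add: emeasure_distr borel_measurable_linear linear_copy_vec)
  also have "\<dots> = (\<Prod>i\<in>UNIV. (u - l) $ Abs_ordered_copy i)"
    using le by (simp add: emeasure_lborel_box_eq prod_Basis_vec inner_axis uncopy_vec_def)
  also have "\<dots> = (\<Prod>i\<in>UNIV. (u - l) $ i)"
    using prod.reindex_bij_betw[OF bij_Abs_ordered_copy, of "($) (u - l)"] by simp
  finally show "emeasure (distr lborel borel copy_vec) (box l u) = (\<Prod>b\<in>Basis. (u - l) \<bullet> b)"
    by (simp add: prod_Basis_vec inner_axis)
qed simp

lemma measure_copy_vec_image:
  fixes A :: "(real^'a::finite) set"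
  assumes "A \<in> sets borel"
  shows "measure lebesgue (copy_vec ` A) = measure lebesgue A"
proof -
  have image: "copy_vec ` A = uncopy_vec -` A"
    by (auto simp: image_iff) (metis copy_uncopy_vec)
  then have borel: "copy_vec ` A \<in> sets borel"
    using measurable_sets[OF borel_measurable_linear[OF linear_uncopy_vec] assms] by simp
  then have "measure lebesgue (copy_vec ` A) = measure (distr lborel borel copy_vec) (copy_vec ` A)"
    by (simp add: distr_lborel_copy_vec)
  also have "\<dots> = measure lborel A"
    using borel by (simp add: measure_distr borel_measurable_linear linear_copy_vec image vimage_def)
  finally show ?thesis
    using assms by simp
qed

lemma measure_simplex_replace_vertex:
  fixes w :: "nat \<Rightarrow> real^'n"
  assumes "j \<le> CARD('n)" "sum c {..CARD('n)} = 1" "x = (\<Sum>k\<le>CARD('n). c k *\<^sub>R w k)"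
  shows "measure lebesgue (simplex_of (w(j := x))) = \<bar>c j\<bar> * measure lebesgue (simplex_of w)"
proof -
  have measure_copy: "measure lebesgue (simplex_of (copy_vec \<circ> u)) = measure lebesgue (simplex_of u)"
    for u :: "nat \<Rightarrow> real^'n"
  proof -
    have "simplex_of (copy_vec \<circ> u) = copy_vec ` simplex_of u"
      by (simp add: simplex_of_def card_ordered_copy image_comp convex_hull_linear_image linear_copy_vec)
    moreover have "simplex_of u \<in> sets borel"
      unfolding simplex_of_def
      by (intro borel_closed compact_imp_closed finite_imp_compact_convex_hull) simp
    ultimately show ?thesis
      by (simp add: measure_copy_vec_image)
  qed
  have copy_x: "copy_vec x = (\<Sum>k\<le>CARD('n ordered_copy). c k *\<^sub>R (copy_vec \<circ> w) k)"
    using assms(3) by (simp add: card_ordered_copy linear_sum linear_scale linear_copy_vec)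
  have "measure lebesgue (simplex_of (w(j := x))) = measure lebesgue (simplex_of (copy_vec \<circ> w(j := x)))"
    by (rule measure_copy[symmetric])
  also have "\<dots> = measure lebesgue (simplex_of ((copy_vec \<circ> w)(j := copy_vec x)))"
    by (rule arg_cong[where f = "\<lambda>u. measure lebesgue (simplex_of u)"]) auto
  also have "\<dots> = \<bar>c j\<bar> * measure lebesgue (simplex_of (copy_vec \<circ> w))"
    using assms(1,2) copy_x
    by (intro measure_simplex_replace_vertex_wellorder) (simp_all add: card_ordered_copy)
  also have "\<dots> = \<bar>c j\<bar> * measure lebesgue (simplex_of w)"
    by (simp only: measure_copy)
  finally show ?thesis .
qed

theorem mainTheorem4:
  fixes v :: "nat \<Rightarrow> real^'n" and j :: nat and x :: "real^'n"
  assumes "nondegenerate_simplex v"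
    and "simplex_of v \<subseteq> unit_cube"
    and "unit_cube \<subseteq> scaled_simplex (real CARD('n)) v"
    and "j \<le> CARD('n)"
    and "x \<in> unit_cube"
  shows "measure lebesgue (simplex_of (v(j := x))) \<le> measure lebesgue (simplex_of v)"
proof -
  have "barycentric v x j \<le> 1"
    by (rule barycentric_le_one_on_unit_cube[OF assms])
  moreover have "(1 - real CARD('n)) / (CARD('n) + 1) \<le> barycentric v x j"
    using assms(3,5) by (intro barycentric_scaled_simplex_ge[OF assms(1) _ _ assms(4)]) auto
  moreover have "-1 \<le> (1 - real CARD('n)) / (CARD('n) + 1)"
    by (simp add: field_simps)
  ultimately have "\<bar>barycentric v x j\<bar> \<le> 1"
    by linarith
  moreover have "measure lebesgue (simplex_of (v(j := x)))
                   = \<bar>barycentric v x j\<bar> * measure lebesgue (simplex_of v)"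
    using assms(1,4)
    by (intro measure_simplex_replace_vertex) (simp_all add: sum_barycentric barycentric_combination)
  ultimately show ?thesis
    by (simp add: mult_left_le_one_le)
qed

end
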